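(* Let $\mu_1,\mu_2$ be two LJSDs, each with equal training and test covariance scales, i.e. $\mathbb{E}_{\mu_i}[\lambda]=\mathbb{E}_{\mu_i}[r]$ for $i=1,2$, and such that $\mu_1\le\mu_2$. Then $B_{\mu_1}\le B_{\mu_2}$ and, if $\sigma_\varepsilon^2\le\omega$, $E_{\mu_1}\le E_{\mu_2}$.
   Context: Parameters: $\phi,\psi>0$, ridge constant $\gamma>0$, label noise $\sigma_\varepsilon^2\ge0$. Activation $\sigma:\mathbb{R}\to\mathbb{R}$, differentiable almost everywhere with $|\sigma(u)|,|\sigma'(u)|\le c_0e^{c_1|u|}$. LJSD: a limiting joint spectral distribution is a probability measure $\mu$ on $\mathbb{R}_+^2$, the law of a pair $(\lambda,r)$ (training eigenvalue, overlap coefficient of the test covariance), supported in $[0,C]^2$ for some $C$, either absolutely continuous or a finite sum of delta masses; $\mathbb{E}_\mu[\lambda],\mathbb{E}_\mu[r]$ are finite and positive. The marginal of $\lambda$ is $\mu_{\text{train}}$. Order: for LJSDs $\mu_1,\mu_2$ with the same marginal of $\lambda$, $\mu_1\le\mu_2$ means that $\mathbb{E}_{\mu_1}[r|\lambda]/\mathbb{E}_{\mu_2}[r|\lambda]$ is nondecreasing in $\lambda$ on the support of $\mu_{\text{train}}$ and $\mathbb{E}_{\mu_1}[r]\le\mathbb{E}_{\mu_2}[r]$. Constants: with $s=\mathbb{E}_\mu[\lambda]$ and $z\sim\mathcal N(0,s)$: $\eta=\mathbb{V}[\sigma(z)]$, $\rho=(\frac1s\mathbb{E}[z\sigma(z)])^2$,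 $\zeta=s\rho$, $\omega=s(\eta/\zeta-1)$ (assumed well defined). With $s_*=\mathbb{E}_\mu[r]$, $(\eta_*,\rho_*,\zeta_*,\omega_* )$ are the same with $s$ replaced by $s_*$; $\xi=\sqrt{\rho_*/\rho}$. Functionals: $\mathcal{I}_{a,b}(x)=\phi\,\mathbb{E}_\mu[\lambda^a(\phi+x\lambda)^{-b}]$, $\mathcal{I}^*_{a,b}(x)=\phi\,\mathbb{E}_\mu[r\lambda^{a-1}(\phi+x\lambda)^{-b}]$. Limiting bias, variance, error of random feature regression: $x$ is the unique nonnegative real root of $x=(1-\gamma\tau)/(\omega+\mathcal{I}_{1,1}(x))$, with $\tau=\frac{\sqrt{(\psi-\phi)^2+4x\psi\phi\gamma/\rho}+\psi-\phi}{2\psi\gamma}$, $\bar\tau=\frac{\phi-\psi}{\phi}\frac1\gamma+\frac\psi\phi\tau$, $\frac{\partial x}{\partial\gamma}=-\frac{x}{\gamma+\rho\gamma(\tau\psi/\phi+\bar\tau)(\omega+\phi\mathcal{I}_{1,2})}$. With functionals evaluated at $x$, $B_\mu=(1-\xi)^2s_*+2(1-\xi)\xi\mathcal{I}^*_{1,1}+\xi^2\phi\mathcal{I}^*_{1,2}$, $V_\mu=-\rho\xi^2\frac\psi\phi\frac{\partial x}{\partial\gamma}\big(\mathcal{I}_{1,1}(\omega+\phi\mathcal{I}_{1,2})(\omega_*+\mathcal{I}^*_{1,1})+\frac{\phi^2}\psi\gamma\bar\tau\mathcal{I}_{1,2}\mathcal{I}^*_{2,2}+\gamma\tau\mathcal{I}_{2,2}(\omega_*+\phi\mathcal{I}^*_{1,2})+\sigma_\varepsilon^2((\omega+\phi\mathcal{I}_{1,2})(\omega_*+\mathcal{I}^*_{1,1})+\frac\phi\psi\gamma\bar\tau\mathcal{I}^*_{2,2})\big)$,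 and $E_\mu=B_\mu+V_\mu$. *)

theory Defs
  imports "HOL-Probability.Probability"
begin

section \<open>Limiting joint spectral distributions\<close>

text \<open>A point of the plane is a pair (training eigenvalue, overlap coefficient). Finiteness of the
  two means is automatic from bounded support.\<close>

definition ljsd :: "(real \<times> real) measure \<Rightarrow> bool" where
  "ljsd \<mu> \<longleftrightarrow> prob_space \<mu> \<and> sets \<mu> = sets borel \<and>
     (\<exists>C. AE p in \<mu>. p \<in> {0..C} \<times> {0..C}) \<and>
     (absolutely_continuous lborel \<mu> \<or> (\<exists>A. finite A \<and> (AE p in \<mu>. p \<in> A))) \<and>
     (\<integral>p. fst p \<partial>\<mu>) > 0 \<and> (\<integral>p. snd p \<partial>\<mu>) > 0"

definition train_marginal :: "(real \<times> real) measure \<Rightarrow> real measure" where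
  "train_marginal \<mu> = distr \<mu> borel fst"

definition train_scale :: "(real \<times> real) measure \<Rightarrow> real" where
  "train_scale \<mu> = (\<integral>p. fst p \<partial>\<mu>)"

definition test_scale :: "(real \<times> real) measure \<Rightarrow> real" where
  "test_scale \<mu> = (\<integral>p. snd p \<partial>\<mu>)"

text \<open>\<open>g\<close> is a version of the conditional expectation of the overlap coefficient given the training
  eigenvalue, seen as a function of the eigenvalue.\<close>

definition cond_overlap :: "(real \<times> real) measure \<Rightarrow> (real \<Rightarrow> real) \<Rightarrow> bool" where
  "cond_overlap \<mu> g \<longleftrightarrow> g \<in> borel_measurable borel \<and>
     (AE p in \<mu>. real_cond_exp \<mu> (vimage_algebra (space \<mu>) fst borel) snd p = g (fst p))"

text \<open>Conditional expectations are determined only up to null sets of the training marginal, so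
  ``nondecreasing on the support'' is required on a set \<open>S\<close> of full measure (for a marginal with
  finitely many atoms, \<open>S\<close> contains all of them). Positivity of \<open>g2\<close> on \<open>S\<close> says that the ratio is
  defined there.\<close>

definition ljsd_le :: "(real \<times> real) measure \<Rightarrow> (real \<times> real) measure \<Rightarrow> bool" where
  "ljsd_le \<mu>1 \<mu>2 \<longleftrightarrow> train_marginal \<mu>1 = train_marginal \<mu>2 \<and>
     (\<exists>g1 g2 S. cond_overlap \<mu>1 g1 \<and> cond_overlap \<mu>2 g2 \<and>
        S \<in> sets borel \<and> (AE l in train_marginal \<mu>1. l \<in> S) \<and>
        (\<forall>l\<in>S. g2 l > 0) \<and> mono_on S (\<lambda>l. g1 l / g2 l)) \<and>
     test_scale \<mu>1 \<le> test_scale \<mu>2"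

section \<open>Activation function and Gaussian constants\<close>

definition admissible_activation :: "(real \<Rightarrow> real) \<Rightarrow> bool" where
  "admissible_activation \<sigma> \<longleftrightarrow>
     (AE u in lborel. \<sigma> differentiable (at u)) \<and>
     (\<exists>c0 c1. (\<forall>u. \<bar>\<sigma> u\<bar> \<le> c0 * exp (c1 * \<bar>u\<bar>)) \<and>
              (AE u in lborel. \<bar>deriv \<sigma> u\<bar> \<le> c0 * exp (c1 * \<bar>u\<bar>)))"

text \<open>Expectation of \<open>f z\<close> for a centred Gaussian \<open>z\<close> of variance \<open>s\<close>. The integral is over
  \<^const>\<open>lebesgue\<close> and not \<^const>\<open>lborel\<close>, because an almost everywhere differentiable
  function is Lebesgue measurable but not necessarily Borel measurable.\<close>

definition gauss_exp :: "real \<Rightarrow> (real \<Rightarrow> real) \<Rightarrow> real" where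
  "gauss_exp s f = (\<integral>z. normal_density 0 (sqrt s) z * f z \<partial>lebesgue)"

definition act_eta :: "(real \<Rightarrow> real) \<Rightarrow> real \<Rightarrow> real" where
  "act_eta \<sigma> s = gauss_exp s (\<lambda>z. (\<sigma> z - gauss_exp s \<sigma>)\<^sup>2)"

definition act_rho :: "(real \<Rightarrow> real) \<Rightarrow> real \<Rightarrow> real" where
  "act_rho \<sigma> s = (1 / s * gauss_exp s (\<lambda>z. z * \<sigma> z))\<^sup>2"

definition act_zeta :: "(real \<Rightarrow> real) \<Rightarrow> real \<Rightarrow> real" where
  "act_zeta \<sigma> s = s * act_rho \<sigma> s"

definition act_omega :: "(real \<Rightarrow> real) \<Rightarrow> real \<Rightarrow> real" where
  "act_omega \<sigma> s = s * (act_eta \<sigma> s / act_zeta \<sigma> s - 1)"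

definition act_xi :: "(real \<Rightarrow> real) \<Rightarrow> (real \<times> real) measure \<Rightarrow> real" where
  "act_xi \<sigma> \<mu> = sqrt (act_rho \<sigma> (test_scale \<mu>) / act_rho \<sigma> (train_scale \<mu>))"

section \<open>Spectral functionals\<close>

definition spec_I :: "real \<Rightarrow> (real \<times> real) measure \<Rightarrow> nat \<Rightarrow> nat \<Rightarrow> real \<Rightarrow> real" where
  "spec_I \<phi> \<mu> a b x = \<phi> * (\<integral>(l, r). l ^ a / (\<phi> + x * l) ^ b \<partial>\<mu>)"

text \<open>The integer power gives the exponent \<open>a - 1\<close> without truncation at \<open>a = 0\<close>.\<close>

definition spec_I_star :: "real \<Rightarrow> (real \<times> real) measure \<Rightarrow> nat \<Rightarrow> nat \<Rightarrow> real \<Rightarrow> real" where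
  "spec_I_star \<phi> \<mu> a b x = \<phi> * (\<integral>(l, r). r * l powi (int a - 1) / (\<phi> + x * l) ^ b \<partial>\<mu>)"

section \<open>Limiting bias, variance and error\<close>

definition tau_of :: "real \<Rightarrow> real \<Rightarrow> real \<Rightarrow> real \<Rightarrow> real \<Rightarrow> real" where
  "tau_of \<phi> \<psi> \<gamma> \<rho> x =
     (sqrt ((\<psi> - \<phi>)\<^sup>2 + 4 * x * \<psi> * \<phi> * \<gamma> / \<rho>) + \<psi> - \<phi>) / (2 * \<psi> * \<gamma>)"

definition tau_bar_of :: "real \<Rightarrow> real \<Rightarrow> real \<Rightarrow> real \<Rightarrow> real \<Rightarrow> real" where
  "tau_bar_of \<phi> \<psi> \<gamma> \<rho> x = (\<phi> - \<psi>) / \<phi> * (1 / \<gamma>) + \<psi> / \<phi> * tau_of \<phi> \<psi> \<gamma> \<rho> x"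

definition x_root :: "real \<Rightarrow> real \<Rightarrow> real \<Rightarrow> (real \<Rightarrow> real) \<Rightarrow> (real \<times> real) measure \<Rightarrow> real" where
  "x_root \<phi> \<psi> \<gamma> \<sigma> \<mu> =
     (THE x. 0 \<le> x \<and>
        x = (1 - \<gamma> * tau_of \<phi> \<psi> \<gamma> (act_rho \<sigma> (train_scale \<mu>)) x) /
            (act_omega \<sigma> (train_scale \<mu>) + spec_I \<phi> \<mu> 1 1 x))"

text \<open>The closed form of the derivative of the root in the ridge constant \<open>\<gamma>\<close>.\<close>

definition dx_dgamma :: "real \<Rightarrow> real \<Rightarrow> real \<Rightarrow> (real \<Rightarrow> real) \<Rightarrow> (real \<times> real) measure \<Rightarrow> real" where
  "dx_dgamma \<phi> \<psi> \<gamma> \<sigma> \<mu> =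
     (let x = x_root \<phi> \<psi> \<gamma> \<sigma> \<mu>;
          \<rho> = act_rho \<sigma> (train_scale \<mu>);
          \<omega> = act_omega \<sigma> (train_scale \<mu>);
          \<tau> = tau_of \<phi> \<psi> \<gamma> \<rho> x;
          \<tau>b = tau_bar_of \<phi> \<psi> \<gamma> \<rho> x
      in - (x / (\<gamma> + \<rho> * \<gamma> * (\<tau> * \<psi> / \<phi> + \<tau>b) * (\<omega> + \<phi> * spec_I \<phi> \<mu> 1 2 x))))"

definition limit_bias ::
  "real \<Rightarrow> real \<Rightarrow> real \<Rightarrow> (real \<Rightarrow> real) \<Rightarrow> (real \<times> real) measure \<Rightarrow> real" where
  "limit_bias \<phi> \<psi> \<gamma> \<sigma> \<mu> =
     (let x = x_root \<phi> \<psi> \<gamma> \<sigma> \<mu>;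
          \<xi> = act_xi \<sigma> \<mu>
      in (1 - \<xi>)\<^sup>2 * test_scale \<mu> + 2 * (1 - \<xi>) * \<xi> * spec_I_star \<phi> \<mu> 1 1 x
         + \<xi>\<^sup>2 * \<phi> * spec_I_star \<phi> \<mu> 1 2 x)"

text \<open>The argument \<open>v\<close> is the variance of the label noise.\<close>

definition limit_variance ::
  "real \<Rightarrow> real \<Rightarrow> real \<Rightarrow> real \<Rightarrow> (real \<Rightarrow> real) \<Rightarrow> (real \<times> real) measure \<Rightarrow> real" where
  "limit_variance \<phi> \<psi> \<gamma> v \<sigma> \<mu> =
     (let x = x_root \<phi> \<psi> \<gamma> \<sigma> \<mu>;
          \<xi> = act_xi \<sigma> \<mu>;
          \<rho> = act_rho \<sigma> (train_scale \<mu>);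
          \<omega> = act_omega \<sigma> (train_scale \<mu>);
          \<omega>s = act_omega \<sigma> (test_scale \<mu>);
          \<tau> = tau_of \<phi> \<psi> \<gamma> \<rho> x;
          \<tau>b = tau_bar_of \<phi> \<psi> \<gamma> \<rho> x;
          I11 = spec_I \<phi> \<mu> 1 1 x;
          I12 = spec_I \<phi> \<mu> 1 2 x;
          I22 = spec_I \<phi> \<mu> 2 2 x;
          J11 = spec_I_star \<phi> \<mu> 1 1 x;
          J12 = spec_I_star \<phi> \<mu> 1 2 x;
          J22 = spec_I_star \<phi> \<mu> 2 2 x
      in - \<rho> * \<xi>\<^sup>2 * (\<psi> / \<phi>) * dx_dgamma \<phi> \<psi> \<gamma> \<sigma> \<mu> *
         (I11 * (\<omega> + \<phi> * I12) * (\<omega>s + J11)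
          + \<phi>\<^sup>2 / \<psi> * \<gamma> * \<tau>b * I12 * J22
          + \<gamma> * \<tau> * I22 * (\<omega>s + \<phi> * J12)
          + v * ((\<omega> + \<phi> * I12) * (\<omega>s + J11) + \<phi> / \<psi> * \<gamma> * \<tau>b * J22)))"

definition limit_error ::
  "real \<Rightarrow> real \<Rightarrow> real \<Rightarrow> real \<Rightarrow> (real \<Rightarrow> real) \<Rightarrow> (real \<times> real) measure \<Rightarrow> real" where
  "limit_error \<phi> \<psi> \<gamma> v \<sigma> \<mu> = limit_bias \<phi> \<psi> \<gamma> \<sigma> \<mu> + limit_variance \<phi> \<psi> \<gamma> v \<sigma> \<mu>"

end

theory Submission
  imports Defs
begin

text \<open>Equality of the scales forces \<open>\<xi> = 1\<close> and \<open>\<omega>\<^sub>* = \<omega>\<close>, and \<open>x\<close> depends on the measure only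
  through the training marginal, so it is the same for both measures. Since \<open>x J22 = J11 - \<phi> J12\<close>
  (where \<open>Jab\<close> stands for the starred functionals), bias and error are affine functions of
  \<open>J11 = \<phi> E[r / (\<phi> + x \<lambda>)]\<close> and \<open>J12 = \<phi> E[r / (\<phi> + x \<lambda>)\<^sup>2]\<close> whose coefficients depend on the
  marginal alone; for the error they are nonnegative when \<open>\<sigma>\<epsilon>2 \<le> \<omega>\<close>. Both \<open>J11\<close> and \<open>J12\<close> average
  \<open>r\<close> against a decreasing function of \<open>\<lambda>\<close>, so Chebyshev's sum inequality compares them.\<close>

section \<open>Gaussian constants\<close>

text \<open>Completing the square turns the density times \<open>exp (c * z)\<close> into a multiple
  of a shifted normal density, and \<open>exp (c * \<bar>z\<bar>)\<close> is at most the sum of the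
  exponentials with slopes \<open>c\<close> and \<open>- c\<close>. This supplies dominating
  functions for an activation of exponential growth.\<close>

lemma integrable_normal_density_exp_abs:
  assumes "s > 0"
  shows "integrable lebesgue (\<lambda>z. normal_density 0 s z * exp (c * \<bar>z\<bar>))"
proof -
  have shift: "normal_density 0 s z * exp (c * z) = exp (c\<^sup>2 * s\<^sup>2 / 2) * normal_density (c * s\<^sup>2) s z"
    for c z
  proof -
    have "- (z - 0)\<^sup>2 / (2 * s\<^sup>2) + c * z = c\<^sup>2 * s\<^sup>2 / 2 + - (z - c * s\<^sup>2)\<^sup>2 / (2 * s\<^sup>2)"
      using assms by (simp add: field_simps power2_eq_square)
    then have "exp (- (z - 0)\<^sup>2 / (2 * s\<^sup>2)) * exp (c * z) =
        exp (c\<^sup>2 * s\<^sup>2 / 2) * exp (- (z - c * s\<^sup>2)\<^sup>2 / (2 * s\<^sup>2))"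
      by (simp only: exp_add[symmetric])
    then show ?thesis
      by (simp add: normal_density_def)
  qed
  have "integrable lborel (\<lambda>z. normal_density 0 s z * exp (c * \<bar>z\<bar>))"
  proof (rule Bochner_Integration.integrable_bound)
    show "integrable lborel
        (\<lambda>z. normal_density 0 s z * exp (c * z) + normal_density 0 s z * exp ((- c) * z))"
      unfolding shift using assms by (intro Bochner_Integration.integrable_add integrable_mult_right) auto
    show "AE z in lborel. norm (normal_density 0 s z * exp (c * \<bar>z\<bar>))
        \<le> norm (normal_density 0 s z * exp (c * z) + normal_density 0 s z * exp ((- c) * z))"
    proof (rule AE_I2)
      fix z :: real
      have "exp (c * \<bar>z\<bar>) \<le> exp (c * z) + exp (- c * z)"
        by (cases "z \<ge> 0") auto
      then have "normal_density 0 s z * exp (c * \<bar>z\<bar>)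
          \<le> normal_density 0 s z * (exp (c * z) + exp (- c * z))"
        by (intro mult_left_mono) auto
      then show "norm (normal_density 0 s z * exp (c * \<bar>z\<bar>))
        \<le> norm (normal_density 0 s z * exp (c * z) + normal_density 0 s z * exp ((- c) * z))"
        by (simp add: distrib_left)
    qed
  qed simp
  then show ?thesis
    by (simp add: integrable_completion)
qed

text \<open>Bessel's inequality: the difference of the two sides is the mean square of the residual
  in the linear regression of \<open>\<sigma> z\<close> on \<open>z\<close>. It is the source of
  \<omega> \<ge> 0.\<close>

lemma act_zeta_le_act_eta:
  assumes s: "s > 0" and \<sigma>: "admissible_activation \<sigma>" and "act_zeta \<sigma> s \<noteq> 0"
  shows "act_zeta \<sigma> s \<le> act_eta \<sigma> s"
proof -
  define N where "N = normal_density 0 (sqrt s)"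
  define k where "k = gauss_exp s (\<lambda>z. z * \<sigma> z)"
  define m where "m = gauss_exp s \<sigma>"
  have N_pos: "N z > 0" for z
    unfolding N_def using s by (intro normal_density_pos) auto
  have N_meas[measurable]: "N \<in> borel_measurable lebesgue"
    unfolding N_def by (rule measurable_completion) simp
  have [measurable]: "(\<lambda>z::real. z) \<in> borel_measurable lebesgue"
    by (rule measurable_completion) simp
  \<comment> \<open>A nonintegrable function has Bochner integral 0 by convention, so a nonzero
    \<open>k\<close> yields integrability of its integrand, and with it measurability.\<close>
  have "k \<noteq> 0"
    using assms(3) unfolding act_zeta_def act_rho_def k_def by auto
  then have int_zs: "integrable lebesgue (\<lambda>z. N z * (z * \<sigma> z))"
    by (metis k_def gauss_exp_def N_def not_integrable_integral_eq)
  \<comment> \<open>Dividing the integrable product by \<open>N z * z\<close> away from the origin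
    recovers the activation, which is thereby measurable.\<close>
  have "(\<lambda>z. if z = 0 then \<sigma> 0 else (N z * (z * \<sigma> z)) / (N z * z)) \<in> borel_measurable lebesgue"
    using int_zs by measurable
  also have "(\<lambda>z. if z = 0 then \<sigma> 0 else (N z * (z * \<sigma> z)) / (N z * z)) = \<sigma>"
    using N_pos by (force simp: fun_eq_iff less_le)
  finally have \<sigma>_meas[measurable]: "\<sigma> \<in> borel_measurable lebesgue" .
  obtain c0 c1 where c: "\<And>u. \<bar>\<sigma> u\<bar> \<le> c0 * exp (c1 * \<bar>u\<bar>)"
    using \<sigma> unfolding admissible_activation_def by blast
  have c0: "c0 \<ge> 0"
    using c[of 0] by simp
  have int_s: "integrable lebesgue (\<lambda>z. N z * \<sigma> z)"
  proof (rule Bochner_Integration.integrable_bound)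
    show "integrable lebesgue (\<lambda>z. c0 * (N z * exp (c1 * \<bar>z\<bar>)))"
      unfolding N_def using s by (intro integrable_mult_right integrable_normal_density_exp_abs) auto
    show "AE z in lebesgue. norm (N z * \<sigma> z) \<le> norm (c0 * (N z * exp (c1 * \<bar>z\<bar>)))"
    proof (rule AE_I2)
      fix z
      have "N z * \<bar>\<sigma> z\<bar> \<le> N z * (c0 * exp (c1 * \<bar>z\<bar>))"
        using c[of z] N_pos[of z] by (intro mult_left_mono) auto
      then show "norm (N z * \<sigma> z) \<le> norm (c0 * (N z * exp (c1 * \<bar>z\<bar>)))"
        using N_pos[of z] c0 by (simp add: abs_mult mult_ac)
    qed
  qed simp
  have int_s2: "integrable lebesgue (\<lambda>z. N z * (\<sigma> z)\<^sup>2)"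
  proof (rule Bochner_Integration.integrable_bound)
    show "integrable lebesgue (\<lambda>z. c0\<^sup>2 * (N z * exp (2 * c1 * \<bar>z\<bar>)))"
      unfolding N_def using s by (intro integrable_mult_right integrable_normal_density_exp_abs) auto
    show "AE z in lebesgue. norm (N z * (\<sigma> z)\<^sup>2) \<le> norm (c0\<^sup>2 * (N z * exp (2 * c1 * \<bar>z\<bar>)))"
    proof (rule AE_I2)
      fix z
      have "(\<sigma> z)\<^sup>2 \<le> (c0 * exp (c1 * \<bar>z\<bar>))\<^sup>2"
        using power_mono[OF c[of z], of 2] by simp
      also have "\<dots> = c0\<^sup>2 * exp (2 * c1 * \<bar>z\<bar>)"
        by (simp add: power_mult_distrib exp_double[symmetric] mult_ac)
      finally have "N z * (\<sigma> z)\<^sup>2 \<le> N z * (c0\<^sup>2 * exp (2 * c1 * \<bar>z\<bar>))"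
        using N_pos[of z] by (intro mult_left_mono) auto
      then show "norm (N z * (\<sigma> z)\<^sup>2) \<le> norm (c0\<^sup>2 * (N z * exp (2 * c1 * \<bar>z\<bar>)))"
        using N_pos[of z] by (simp add: abs_mult mult_ac)
    qed
  qed simp
  have "has_bochner_integral lborel N 1"
    unfolding N_def using s by (simp add: has_bochner_integral_iff)
  then have N0: "integrable lebesgue N" "integral\<^sup>L lebesgue N = 1"
    by (auto simp: has_bochner_integral_iff integrable_completion integral_completion)
  have "has_bochner_integral lborel (\<lambda>z. N z * z) 0"
    unfolding N_def using normal_moment_odd[of "sqrt s" 0 0] s by simp
  then have N1: "integrable lebesgue (\<lambda>z. N z * z)" "(\<integral>z. N z * z \<partial>lebesgue) = 0"
    by (auto simp: has_bochner_integral_iff integrable_completion integral_completion)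
  have "has_bochner_integral lborel (\<lambda>z. N z * z\<^sup>2) s"
    unfolding N_def using normal_moment_even[of "sqrt s" 0 1] s
    by (simp add: fact_numeral field_simps numeral_2_eq_2)
  then have N2: "integrable lebesgue (\<lambda>z. N z * z\<^sup>2)" "(\<integral>z. N z * z\<^sup>2 \<partial>lebesgue) = s"
    by (auto simp: has_bochner_integral_iff integrable_completion integral_completion)
  have k_eq: "(\<integral>z. N z * (z * \<sigma> z) \<partial>lebesgue) = k"
    unfolding k_def gauss_exp_def N_def ..
  have eta: "act_eta \<sigma> s = (\<integral>z. N z * (\<sigma> z - m)\<^sup>2 \<partial>lebesgue)"
    unfolding act_eta_def gauss_exp_def N_def m_def ..
  have int_c: "integrable lebesgue (\<lambda>z. N z * (\<sigma> z - m)\<^sup>2)"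
  proof -
    have "integrable lebesgue (\<lambda>z. N z * (\<sigma> z)\<^sup>2 - 2 * m * (N z * \<sigma> z) + m\<^sup>2 * N z)"
      using int_s2 int_s N0 by auto
    also have "(\<lambda>z. N z * (\<sigma> z)\<^sup>2 - 2 * m * (N z * \<sigma> z) + m\<^sup>2 * N z) = (\<lambda>z. N z * (\<sigma> z - m)\<^sup>2)"
      by (auto simp: fun_eq_iff power2_eq_square algebra_simps)
    finally show ?thesis .
  qed
  \<comment> \<open>The slope \<open>k / s\<close> is the least-squares one, E[z \<sigma>(z)] /
    E[z^2]; with it the expanded square integrates to
    \<open>act_eta \<sigma> s - act_zeta \<sigma> s\<close>.\<close>
  have "0 \<le> (\<integral>z. N z * (\<sigma> z - m - k / s * z)\<^sup>2 \<partial>lebesgue)"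
    using N_pos by (intro Bochner_Integration.integral_nonneg) (auto simp: less_imp_le)
  also have "(\<lambda>z. N z * (\<sigma> z - m - k / s * z)\<^sup>2) =
      (\<lambda>z. N z * (\<sigma> z - m)\<^sup>2 - 2 * k / s * (N z * (z * \<sigma> z)) + 2 * k / s * m * (N z * z)
        + (k / s)\<^sup>2 * (N z * z\<^sup>2))"
    using s by (auto simp: fun_eq_iff power2_eq_square field_simps)
  also have "(\<integral>z. N z * (\<sigma> z - m)\<^sup>2 - 2 * k / s * (N z * (z * \<sigma> z)) + 2 * k / s * m * (N z * z)
        + (k / s)\<^sup>2 * (N z * z\<^sup>2) \<partial>lebesgue) = act_eta \<sigma> s - 2 * k / s * k + (k / s)\<^sup>2 * s"
    using int_c int_zs N1 N2 by (simp add: eta k_eq)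
  also have "\<dots> = act_eta \<sigma> s - act_zeta \<sigma> s"
    using s unfolding act_zeta_def act_rho_def k_def[symmetric]
    by (simp add: power2_eq_square field_simps)
  finally show ?thesis
    by simp
qed

lemma act_rho_pos:
  assumes "act_zeta \<sigma> s \<noteq> 0"
  shows "act_rho \<sigma> s > 0"
  using assms by (auto simp: act_zeta_def act_rho_def)

lemma act_omega_nonneg:
  assumes "s > 0" "admissible_activation \<sigma>" "act_zeta \<sigma> s \<noteq> 0"
  shows "act_omega \<sigma> s \<ge> 0"
proof -
  have "act_zeta \<sigma> s > 0"
    using assms act_rho_pos by (simp add: act_zeta_def)
  then show ?thesis
    using act_zeta_le_act_eta[OF assms] assms(1) by (simp add: act_omega_def)
qed

section \<open>Comparison of overlaps\<close>

text \<open>Chebyshev by a single sign change: left of the point where the ratio crosses 1,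
  \<open>g1\<close> is below \<open>g2\<close> and \<open>f\<close> is above its crossing value
  \<open>K\<close>; right of it both comparisons flip. So \<open>(f l - K) * (g1 l - g2 l)\<close>
  is never positive on \<open>S\<close>, and the equal totals cancel the terms with
  \<open>K\<close>.\<close>

lemma integral_antimono_mult_le:
  fixes f g1 g2 :: "real \<Rightarrow> real"
  assumes int: "integrable M g1" "integrable M g2"
      "integrable M (\<lambda>l. f l * g1 l)" "integrable M (\<lambda>l. f l * g2 l)"
    and eq: "integral\<^sup>L M g1 = integral\<^sup>L M g2"
    and S: "AE l in M. l \<in> S" "\<And>l. l \<in> S \<Longrightarrow> g2 l > 0" "mono_on S (\<lambda>l. g1 l / g2 l)"
    and f: "antimono_on S f" "\<And>l. l \<in> S \<Longrightarrow> f l \<in> {a..b}"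
  shows "(\<integral>l. f l * g1 l \<partial>M) \<le> (\<integral>l. f l * g2 l \<partial>M)"
proof -
  define L where "L = {l \<in> S. g1 l < g2 l}"
  \<comment> \<open>The value of \<open>f\<close> at the point where the ratio crosses 1.\<close>
  define K where "K = (if L = {} then b else Inf (f ` L))"
  have bdd: "bdd_below (f ` L)"
    using f(2) unfolding L_def by (intro bdd_belowI[of _ a]) auto
  have sign: "(f l - K) * g1 l \<le> (f l - K) * g2 l" if l: "l \<in> S" for l
  proof (cases "g1 l < g2 l")
    case True
    then have "l \<in> L"
      using l by (simp add: L_def)
    then have "K \<le> f l"
      unfolding K_def using bdd by (auto intro!: cInf_lower)
    then show ?thesis
      using True by (intro mult_left_mono) auto
  next
    case False
    have "f l \<le> f l'" if "l' \<in> L" for l'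
    proof -
      have l': "l' \<in> S" "g1 l' / g2 l' < 1"
        using that S(2) by (auto simp: L_def)
      moreover have "1 \<le> g1 l / g2 l"
        using False S(2)[OF l] by simp
      ultimately have "\<not> l \<le> l'"
        using monotone_onD[OF S(3) l l'(1)] by force
      then show ?thesis
        using monotone_onD[OF f(1) l'(1) l] by simp
    qed
    \<comment> \<open>For empty \<open>L\<close> this is the upper bound \<open>b\<close>, the
      default value of \<open>K\<close>; otherwise \<open>f l\<close> is a lower bound of
      \<open>f\<close> on \<open>L\<close>.\<close>
    then have "f l \<le> K"
      using f(2)[OF l] by (auto simp: K_def intro!: cInf_greatest)
    then show ?thesis
      using False by (intro mult_left_mono_neg) auto
  qed
  have "(\<integral>l. f l * g1 l - K * g1 l \<partial>M) \<le> (\<integral>l. f l * g2 l - K * g2 l \<partial>M)"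
  proof (rule integral_mono_AE)
    show "AE l in M. f l * g1 l - K * g1 l \<le> f l * g2 l - K * g2 l"
      using S(1) by eventually_elim (use sign in \<open>simp add: left_diff_distrib\<close>)
  qed (use int in auto)
  then show ?thesis
    using int eq by simp
qed

section \<open>Integrals against an LJSD and their passage to the training marginal\<close>

locale ljsd_measure = prob_space \<mu> for \<mu> :: "(real \<times> real) measure" +
  assumes is_ljsd: "ljsd \<mu>"
begin

lemma sets_eq[measurable_cong]: "sets \<mu> = sets borel"
  using is_ljsd by (simp add: ljsd_def)

lemma space_eq: "space \<mu> = UNIV"
  using sets_eq_imp_space_eq[OF sets_eq] by simp

lemma measurable_coords[measurable]: "fst \<in> borel_measurable \<mu>" "snd \<in> borel_measurable \<mu>"
  by (simp_all add: measurable_cong_sets[OF sets_eq refl] borel_prod[symmetric])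

lemma AE_nonneg: "AE p in \<mu>. 0 \<le> fst p"
proof -
  obtain C where C: "AE p in \<mu>. p \<in> {0..C} \<times> {0..C}"
    using is_ljsd by (auto simp: ljsd_def)
  then show ?thesis
    by eventually_elim auto
qed

text \<open>Bounded support makes the product bounded almost everywhere. The bound on
  \<open>f\<close> is asked only for nonnegative arguments because functions such as
  \<open>1 / (\<phi> + x * l)\<close> with \<open>x > 0\<close> have a pole at a negative
  \<open>l\<close>.\<close>

lemma integrable_fst_mult:
  assumes [measurable]: "f \<in> borel_measurable borel" and K: "\<And>l. 0 \<le> l \<Longrightarrow> \<bar>f l\<bar> \<le> K"
  shows "integrable \<mu> (\<lambda>p. fst p * f (fst p))"
proof -
  obtain C where C: "AE p in \<mu>. p \<in> {0..C} \<times> {0..C}"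
    using is_ljsd by (auto simp: ljsd_def)
  have "AE p in \<mu>. norm (fst p * f (fst p)) \<le> C * K"
    using C by eventually_elim (use K in \<open>auto simp: abs_mult intro!: mult_mono\<close>)
  then show ?thesis
    by (rule integrable_const_bound) measurable
qed

lemma integrable_snd_mult:
  assumes [measurable]: "f \<in> borel_measurable borel" and K: "\<And>l. 0 \<le> l \<Longrightarrow> \<bar>f l\<bar> \<le> K"
  shows "integrable \<mu> (\<lambda>p. snd p * f (fst p))"
proof -
  obtain C where C: "AE p in \<mu>. p \<in> {0..C} \<times> {0..C}"
    using is_ljsd by (auto simp: ljsd_def)
  have "AE p in \<mu>. norm (snd p * f (fst p)) \<le> C * K"
    using C by eventually_elim (use K in \<open>auto simp: abs_mult intro!: mult_mono\<close>)
  then show ?thesis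
    by (rule integrable_const_bound) measurable
qed

lemma train_scale_pos: "train_scale \<mu> > 0"
  using is_ljsd by (simp add: ljsd_def train_scale_def)

lemma integral_train_marginal:
  fixes f :: "real \<Rightarrow> real"
  assumes "f \<in> borel_measurable borel"
  shows "(\<integral>l. f l \<partial>train_marginal \<mu>) = (\<integral>p. f (fst p) \<partial>\<mu>)"
  unfolding train_marginal_def using assms by (intro integral_distr) auto

text \<open>Moves averages of the overlap to the training marginal, which two comparable measures
  share. The factor \<open>f (fst p)\<close> is measurable for the sigma-algebra generated by
  \<open>fst\<close>, so it passes through the conditional expectation.\<close>

lemma
  assumes g: "cond_overlap \<mu> g"
    and f[measurable]: "f \<in> borel_measurable borel" and K: "\<And>l. 0 \<le> l \<Longrightarrow> \<bar>f l\<bar> \<le> K"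
  shows integral_cond_overlap: "(\<integral>p. snd p * f (fst p) \<partial>\<mu>) = (\<integral>l. f l * g l \<partial>train_marginal \<mu>)"
    and integrable_cond_overlap: "integrable (train_marginal \<mu>) (\<lambda>l. f l * g l)"
proof -
  let ?F = "vimage_algebra (space \<mu>) fst borel"
  have g_meas[measurable]: "g \<in> borel_measurable borel"
    and g_AE: "AE p in \<mu>. real_cond_exp \<mu> ?F snd p = g (fst p)"
    using g by (auto simp: cond_overlap_def)
  have sub: "subalgebra \<mu> ?F"
    unfolding subalgebra_def
    by (auto simp: sets_vimage_algebra2 intro!: measurable_sets[OF measurable_coords(1)])
  interpret F: finite_measure_subalgebra \<mu> ?F
    by unfold_locales (rule sub)
  have fF: "(\<lambda>p. f (fst p)) \<in> borel_measurable ?F"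
    by (rule measurable_compose[OF measurable_vimage_algebra1 f]) auto
  have int: "integrable \<mu> (\<lambda>p. f (fst p) * snd p)"
    using integrable_snd_mult[OF f K] by (simp add: mult.commute)
  have AE: "AE p in \<mu>. f (fst p) * real_cond_exp \<mu> ?F snd p = f (fst p) * g (fst p)"
    using g_AE by eventually_elim simp
  have [measurable]: "(\<lambda>p. real_cond_exp \<mu> ?F snd p) \<in> borel_measurable \<mu>"
    by (rule borel_measurable_cond_exp2)
  note c = F.real_cond_exp_intg[OF int fF measurable_coords(2)]
  have "integrable \<mu> (\<lambda>p. f (fst p) * g (fst p))"
    using c(1) by (rule integrable_cong_AE_imp) (use AE in \<open>auto elim: eventually_mono\<close>)
  then show "integrable (train_marginal \<mu>) (\<lambda>l. f l * g l)"
    unfolding train_marginal_def by (subst integrable_distr_eq) auto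
  have "(\<integral>p. snd p * f (fst p) \<partial>\<mu>) = (\<integral>p. f (fst p) * real_cond_exp \<mu> ?F snd p \<partial>\<mu>)"
    using c(2) by (simp add: mult.commute)
  also have "\<dots> = (\<integral>p. f (fst p) * g (fst p) \<partial>\<mu>)"
    using AE by (intro integral_cong_AE) auto
  also have "\<dots> = (\<integral>l. f l * g l \<partial>train_marginal \<mu>)"
    by (intro integral_train_marginal[symmetric]) measurable
  finally show "(\<integral>p. snd p * f (fst p) \<partial>\<mu>) = (\<integral>l. f l * g l \<partial>train_marginal \<mu>)" .
qed

end

lemma ljsd_measureI: "ljsd \<mu> \<Longrightarrow> ljsd_measure \<mu>"
  by (simp add: ljsd_measure_def ljsd_measure_axioms_def ljsd_def)

lemma ljsd_le_integral_antimono: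
  assumes "ljsd \<mu>1" "ljsd \<mu>2" "ljsd_le \<mu>1 \<mu>2" and scale: "test_scale \<mu>1 = test_scale \<mu>2"
    and f: "f \<in> borel_measurable borel" "antimono_on {0..} f" "\<And>l. 0 \<le> l \<Longrightarrow> \<bar>f l\<bar> \<le> K"
  shows "(\<integral>p. snd p * f (fst p) \<partial>\<mu>1) \<le> (\<integral>p. snd p * f (fst p) \<partial>\<mu>2)"
proof -
  interpret A: ljsd_measure \<mu>1 by (rule ljsd_measureI) fact
  interpret B: ljsd_measure \<mu>2 by (rule ljsd_measureI) fact
  obtain g1 g2 S where eq: "train_marginal \<mu>1 = train_marginal \<mu>2"
    and g: "cond_overlap \<mu>1 g1" "cond_overlap \<mu>2 g2"
    and S: "AE l in train_marginal \<mu>1. l \<in> S" "\<forall>l\<in>S. g2 l > 0" "mono_on S (\<lambda>l. g1 l / g2 l)"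
    using assms(3) by (auto simp: ljsd_le_def)
  have "AE l in train_marginal \<mu>1. 0 \<le> l"
    unfolding train_marginal_def using A.AE_nonneg by (subst AE_distr_iff) auto
  \<comment> \<open>The monotonicity and the bound of \<open>f\<close> hold only on the half-line,
    so \<open>S\<close> is cut down to it.\<close>
  with S(1) have S': "AE l in train_marginal \<mu>1. l \<in> S \<inter> {0..}"
    by eventually_elim simp
  \<comment> \<open>Testing with the constant 1 identifies the integrals of \<open>g1\<close> and
    \<open>g2\<close> with the two test scales; their equality is the equal-totals condition of the
    Chebyshev argument.\<close>
  have one: "(\<lambda>_::real. 1::real) \<in> borel_measurable borel" "\<And>l::real. 0 \<le> l \<Longrightarrow> \<bar>1::real\<bar> \<le> 1"
    by auto
  have tot: "integral\<^sup>L (train_marginal \<mu>1) g1 = integral\<^sup>L (train_marginal \<mu>1) g2"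
    using A.integral_cond_overlap[OF g(1) one] B.integral_cond_overlap[OF g(2) one] scale
    by (simp add: test_scale_def eq)
  have "(\<integral>l. f l * g1 l \<partial>train_marginal \<mu>1) \<le> (\<integral>l. f l * g2 l \<partial>train_marginal \<mu>1)"
  proof (rule integral_antimono_mult_le)
    show "integrable (train_marginal \<mu>1) g1"
      using A.integrable_cond_overlap[OF g(1) one] by simp
    show "integrable (train_marginal \<mu>1) g2"
      using B.integrable_cond_overlap[OF g(2) one] by (simp add: eq)
    show "integrable (train_marginal \<mu>1) (\<lambda>l. f l * g1 l)"
      by (rule A.integrable_cond_overlap[OF g(1) f(1,3)])
    show "integrable (train_marginal \<mu>1) (\<lambda>l. f l * g2 l)"
      unfolding eq by (rule B.integrable_cond_overlap[OF g(2) f(1,3)])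
    show "mono_on (S \<inter> {0..}) (\<lambda>l. g1 l / g2 l)"
      using S(3) by (rule monotone_on_subset) auto
    show "antimono_on (S \<inter> {0..}) f"
      using f(2) by (rule monotone_on_subset) auto
    show "f l \<in> {- K..K}" if "l \<in> S \<inter> {0..}" for l
      using f(3)[of l] that by auto
  qed (use S S' tot in auto)
  then show ?thesis
    using A.integral_cond_overlap[OF g(1) f(1,3)] B.integral_cond_overlap[OF g(2) f(1,3)]
    by (simp add: eq)
qed

section \<open>The fixed point equation\<close>

lemma tau_of_nonneg:
  assumes "\<phi> > 0" "\<psi> > 0" "\<gamma> > 0" "\<rho> > 0" "x \<ge> 0"
  shows "tau_of \<phi> \<psi> \<gamma> \<rho> x \<ge> 0"
proof -
  have "\<bar>\<psi> - \<phi>\<bar> \<le> sqrt ((\<psi> - \<phi>)\<^sup>2 + 4 * x * \<psi> * \<phi> * \<gamma> / \<rho>)"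
    using assms by (intro real_le_rsqrt) auto
  then show ?thesis
    using assms by (simp add: tau_of_def)
qed

text \<open>\<open>tau_bar_of\<close> is \<open>tau_of\<close> with \<phi> and \<psi> exchanged, the
  radicand being symmetric in them.\<close>

lemma tau_bar_of_nonneg:
  assumes "\<phi> > 0" "\<psi> > 0" "\<gamma> > 0" "\<rho> > 0" "x \<ge> 0"
  shows "tau_bar_of \<phi> \<psi> \<gamma> \<rho> x \<ge> 0"
proof -
  let ?q = "sqrt ((\<psi> - \<phi>)\<^sup>2 + 4 * x * \<psi> * \<phi> * \<gamma> / \<rho>)"
  have "\<bar>\<psi> - \<phi>\<bar> \<le> ?q"
    using assms by (intro real_le_rsqrt) auto
  moreover have "tau_bar_of \<phi> \<psi> \<gamma> \<rho> x = (?q + \<phi> - \<psi>) / (2 * \<phi> * \<gamma>)"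
    using assms by (simp add: tau_bar_of_def tau_of_def field_simps)
  ultimately show ?thesis
    using assms by simp
qed

lemma tau_of_strict_mono:
  assumes "\<phi> > 0" "\<psi> > 0" "\<gamma> > 0" "\<rho> > 0" "x < y"
  shows "tau_of \<phi> \<psi> \<gamma> \<rho> x < tau_of \<phi> \<psi> \<gamma> \<rho> y"
  using assms unfolding tau_of_def
  by (intro divide_strict_right_mono diff_strict_right_mono add_strict_right_mono real_sqrt_less_mono
      add_strict_left_mono mult_strict_right_mono) auto

context ljsd_measure
begin

context
  fixes \<phi> :: real
  assumes phi_pos: "\<phi> > 0"
begin

section \<open>Bounds, positivity and continuity of the spectral functionals\<close>

lemma denom_pos: "0 \<le> x \<Longrightarrow> 0 \<le> l \<Longrightarrow> 0 < \<phi> + x * l"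
  using phi_pos by (simp add: add_pos_nonneg)

lemma inverse_denom_power_bounded:
  assumes "0 \<le> x" "0 \<le> l"
  shows "\<bar>1 / (\<phi> + x * l) ^ b\<bar> \<le> 1 / \<phi> ^ b"
  using assms phi_pos denom_pos[OF assms] by (simp add: frac_le power_mono)

lemma spec_I_eq: "spec_I \<phi> \<mu> a b x = \<phi> * (\<integral>l. l ^ a / (\<phi> + x * l) ^ b \<partial>train_marginal \<mu>)"
  unfolding spec_I_def by (subst integral_train_marginal) (auto simp: case_prod_unfold)

lemma spec_I_nonneg: "0 \<le> x \<Longrightarrow> 0 \<le> spec_I \<phi> \<mu> a b x"
  unfolding spec_I_def case_prod_unfold using phi_pos AE_nonneg
  by (intro mult_nonneg_nonneg Bochner_Integration.integral_nonneg_AE)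
    (auto elim!: eventually_mono simp: denom_pos less_imp_le)

text \<open>A vanishing integral would force \<lambda> = 0 almost everywhere, against the positive
  training scale. Strict positivity keeps the denominator of the fixed point equation positive even
  when \<omega> = 0.\<close>

lemma spec_I_1_1_pos:
  assumes "0 \<le> x"
  shows "0 < spec_I \<phi> \<mu> 1 1 x"
proof -
  let ?h = "\<lambda>p::real \<times> real. fst p * (1 / (\<phi> + x * fst p))"
  have int: "integrable \<mu> ?h"
    using inverse_denom_power_bounded[OF assms, of _ 1]
    by (intro integrable_fst_mult[where K = "1 / \<phi>"]) auto
  have nn: "AE p in \<mu>. 0 \<le> ?h p"
    using AE_nonneg by eventually_elim (use denom_pos[OF assms] in \<open>auto simp: less_imp_le\<close>)
  have "(\<integral>p. ?h p \<partial>\<mu>) \<noteq> 0"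
  proof
    assume "(\<integral>p. ?h p \<partial>\<mu>) = 0"
    then have "AE p in \<mu>. ?h p = 0"
      using integral_nonneg_eq_0_iff_AE[OF int nn] by simp
    with AE_nonneg have "AE p in \<mu>. fst p = 0"
      by eventually_elim (use denom_pos[OF assms] in \<open>force simp: less_le\<close>)
    then have "train_scale \<mu> = 0"
      unfolding train_scale_def by (rule integral_eq_zero_AE)
    then show False
      using train_scale_pos by simp
  qed
  moreover have "(\<integral>p. ?h p \<partial>\<mu>) \<ge> 0"
    using nn by (rule Bochner_Integration.integral_nonneg_AE)
  ultimately have "(\<integral>p. ?h p \<partial>\<mu>) > 0"
    by linarith
  then show ?thesis
    using phi_pos by (simp add: spec_I_def case_prod_unfold)
qed

text \<open>Together these bounds make \<open>x * spec_I \<phi> \<mu> 1 1 x\<close> nondecreasing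
  and Lipschitz, which is what existence and uniqueness of the root need.\<close>

lemma
  assumes "0 \<le> x" "x \<le> y"
  shows mult_spec_I_1_1_mono: "x * spec_I \<phi> \<mu> 1 1 x \<le> y * spec_I \<phi> \<mu> 1 1 y"
    and mult_spec_I_1_1_growth:
      "y * spec_I \<phi> \<mu> 1 1 y - x * spec_I \<phi> \<mu> 1 1 x \<le> train_scale \<mu> * (y - x)"
proof -
  let ?h = "\<lambda>z (p::real \<times> real). (z * \<phi>) * (fst p * (1 / (\<phi> + z * fst p)))"
  have int: "integrable \<mu> (?h z)" if "0 \<le> z" for z
    using inverse_denom_power_bounded[OF that, of _ 1]
    by (intro integrable_mult_right integrable_fst_mult[where K = "1 / \<phi>"]) auto
  have eq: "z * spec_I \<phi> \<mu> 1 1 z = (\<integral>p. ?h z p \<partial>\<mu>)" for z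
    by (simp only: integral_mult_right_zero) (simp add: spec_I_def case_prod_unfold)
  have int_fst: "integrable \<mu> fst"
    using integrable_fst_mult[of "\<lambda>_. 1" 1] by simp
  \<comment> \<open>Over the common denominator the mixed terms cancel, leaving
    \<open>fst p * (y - x)\<close> times two fractions in [0, 1]; both bounds follow from this
    form.\<close>
  have diff: "?h y p - ?h x p = fst p * (y - x) * (\<phi> / (\<phi> + x * fst p)) * (\<phi> / (\<phi> + y * fst p))"
    if "0 \<le> fst p" for p
  proof -
    have "\<phi> + x * fst p \<noteq> 0" "\<phi> + y * fst p \<noteq> 0"
      using denom_pos[of x "fst p"] denom_pos[of y "fst p"] assms that by auto
    then show ?thesis
      by (simp add: divide_simps) (simp add: algebra_simps)
  qed
  have frac: "0 \<le> \<phi> / (\<phi> + z * l)" "\<phi> / (\<phi> + z * l) \<le> 1" if "0 \<le> z" "0 \<le> l" for z l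
    using denom_pos[OF that] that phi_pos by auto
  have "(\<integral>p. ?h x p \<partial>\<mu>) \<le> (\<integral>p. ?h y p \<partial>\<mu>)"
  proof (rule integral_mono_AE)
    show "AE p in \<mu>. ?h x p \<le> ?h y p"
      using AE_nonneg
    proof eventually_elim
      case (elim p)
      then have "0 \<le> ?h y p - ?h x p"
        unfolding diff[OF elim] using assms frac by (intro mult_nonneg_nonneg) auto
      then show ?case by simp
    qed
  qed (use int assms in auto)
  then show "x * spec_I \<phi> \<mu> 1 1 x \<le> y * spec_I \<phi> \<mu> 1 1 y"
    unfolding eq .
  have "(\<integral>p. ?h y p - ?h x p \<partial>\<mu>) \<le> (\<integral>p. fst p * (y - x) \<partial>\<mu>)"
  proof (rule integral_mono_AE)
    show "AE p in \<mu>. ?h y p - ?h x p \<le> fst p * (y - x)"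
      using AE_nonneg
    proof eventually_elim
      case (elim p)
      have "fst p * (y - x) * (\<phi> / (\<phi> + x * fst p)) * (\<phi> / (\<phi> + y * fst p))
          \<le> fst p * (y - x) * 1 * 1"
        using assms elim frac by (intro mult_mono mult_nonneg_nonneg) auto
      then show ?case
        unfolding diff[OF elim] by simp
    qed
  qed (use int int_fst assms in \<open>auto intro: Bochner_Integration.integrable_diff\<close>)
  moreover have "(\<integral>p. ?h y p - ?h x p \<partial>\<mu>) = (\<integral>p. ?h y p \<partial>\<mu>) - (\<integral>p. ?h x p \<partial>\<mu>)"
    using int assms by (intro Bochner_Integration.integral_diff) auto
  ultimately show "y * spec_I \<phi> \<mu> 1 1 y - x * spec_I \<phi> \<mu> 1 1 x \<le> train_scale \<mu> * (y - x)"
    unfolding eq by (simp add: train_scale_def)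
qed

lemma continuous_on_mult_spec_I_1_1: "continuous_on {0..} (\<lambda>x. x * spec_I \<phi> \<mu> 1 1 x)"
proof (rule lipschitz_on_continuous_on, rule lipschitz_onI)
  let ?G = "\<lambda>x. x * spec_I \<phi> \<mu> 1 1 x"
  have le: "dist (?G x) (?G y) \<le> train_scale \<mu> * dist x y" if "0 \<le> x" "x \<le> y" for x y
    using mult_spec_I_1_1_mono[OF that] mult_spec_I_1_1_growth[OF that] that
    by (simp add: dist_real_def)
  show "dist (?G x) (?G y) \<le> train_scale \<mu> * dist x y" if "x \<in> {0..}" "y \<in> {0..}" for x y
    using that le[of x y] le[of y x] by (cases x y rule: linorder_cases) (auto simp: dist_commute)
  show "0 \<le> train_scale \<mu>"
    using train_scale_pos by simp
qed

text \<open>The definite description says nothing until existence and uniqueness are known. Clearing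
  the positive denominator turns the equation into \<open>F x = 1\<close> with \<open>F\<close>
  continuous and strictly increasing, and the intermediate value theorem applies on
  \<open>{0..\<rho> / \<gamma>}\<close>.\<close>

lemma x_root_nonneg:
  assumes pos: "\<psi> > 0" "\<gamma> > 0" and \<rho>: "act_rho \<sigma> (train_scale \<mu>) > 0"
    and \<omega>: "act_omega \<sigma> (train_scale \<mu>) \<ge> 0"
  shows "x_root \<phi> \<psi> \<gamma> \<sigma> \<mu> \<ge> 0"
proof -
  define \<rho> where "\<rho> = act_rho \<sigma> (train_scale \<mu>)"
  define \<omega> where "\<omega> = act_omega \<sigma> (train_scale \<mu>)"
  define F where "F = (\<lambda>x. x * \<omega> + x * spec_I \<phi> \<mu> 1 1 x + \<gamma> * tau_of \<phi> \<psi> \<gamma> \<rho> x)"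
  let ?P = "\<lambda>x. 0 \<le> x \<and> x = (1 - \<gamma> * tau_of \<phi> \<psi> \<gamma> \<rho> x) / (\<omega> + spec_I \<phi> \<mu> 1 1 x)"
  have r: "\<rho> > 0" and w: "\<omega> \<ge> 0"
    using \<rho> \<omega> by (auto simp: \<rho>_def \<omega>_def)
  have P_iff: "?P x \<longleftrightarrow> 0 \<le> x \<and> F x = 1" for x
  proof (cases "0 \<le> x")
    case True
    then have "\<omega> + spec_I \<phi> \<mu> 1 1 x > 0"
      using spec_I_1_1_pos[of x] w by simp
    then have "?P x \<longleftrightarrow> x * (\<omega> + spec_I \<phi> \<mu> 1 1 x) = 1 - \<gamma> * tau_of \<phi> \<psi> \<gamma> \<rho> x"
      using True by (simp only: eq_divide_eq) simp
    then show ?thesis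
      using True by (simp add: F_def distrib_left eq_diff_eq)
  qed simp
  \<comment> \<open>Strictness comes from the \<open>tau_of\<close> term alone; the other two are
    nondecreasing.\<close>
  have F_less: "F x < F y" if "0 \<le> x" "x < y" for x y
  proof -
    have "x * \<omega> \<le> y * \<omega>"
      using that w by (intro mult_right_mono) auto
    moreover have "\<gamma> * tau_of \<phi> \<psi> \<gamma> \<rho> x < \<gamma> * tau_of \<phi> \<psi> \<gamma> \<rho> y"
      using tau_of_strict_mono[OF phi_pos pos r that(2)] pos by simp
    ultimately show ?thesis
      using mult_spec_I_1_1_mono[of x y] that by (simp add: F_def)
  qed
  have "continuous_on {0..\<rho> / \<gamma>} (\<lambda>x. tau_of \<phi> \<psi> \<gamma> \<rho> x)"
    unfolding tau_of_def using r pos by (intro continuous_intros) auto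
  moreover have "continuous_on {0..\<rho> / \<gamma>} (\<lambda>x. x * spec_I \<phi> \<mu> 1 1 x)"
    by (rule continuous_on_subset[OF continuous_on_mult_spec_I_1_1]) auto
  ultimately have cont: "continuous_on {0..\<rho> / \<gamma>} F"
    unfolding F_def by (intro continuous_on_add continuous_on_mult_left
        continuous_on_mult_right continuous_on_id)
  \<comment> \<open>Only the \<open>tau_of\<close> term survives at 0, with value max(0, 1 -
    \<phi>/\<psi>).\<close>
  have "F 0 \<le> 1"
    using pos phi_pos by (simp add: F_def tau_of_def divide_simps)
  \<comment> \<open>The right endpoint is chosen so that the radicand becomes the square of \<psi> +
    \<phi>; the \<open>tau_of\<close> term then equals 1 by itself.\<close>
  moreover have "F (\<rho> / \<gamma>) \<ge> 1"
  proof -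
    have "(\<psi> - \<phi>)\<^sup>2 + 4 * (\<rho> / \<gamma>) * \<psi> * \<phi> * \<gamma> / \<rho> = (\<psi> + \<phi>)\<^sup>2"
      using r pos by (simp add: power2_eq_square field_simps)
    then have "\<gamma> * tau_of \<phi> \<psi> \<gamma> \<rho> (\<rho> / \<gamma>) = 1"
      unfolding tau_of_def using pos phi_pos by simp
    then show ?thesis
      using r w pos spec_I_nonneg[of "\<rho> / \<gamma>" 1 1] by (simp add: F_def)
  qed
  moreover have "0 \<le> \<rho> / \<gamma>"
    using r pos by simp
  ultimately obtain x where x: "0 \<le> x" "F x = 1"
    using IVT'[of F 0 1 "\<rho> / \<gamma>"] cont by blast
  have "y = x" if "0 \<le> y" "F y = 1" for y
    using that x F_less[of x y] F_less[of y x] by (cases x y rule: linorder_cases) auto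
  then have "(THE x. ?P x) = x"
    unfolding P_iff using x by (intro the_equality) blast+
  then have "x_root \<phi> \<psi> \<gamma> \<sigma> \<mu> = x"
    unfolding x_root_def \<rho>_def \<omega>_def .
  then show ?thesis
    using x by simp
qed

lemma spec_I_star_1_eq:
  "spec_I_star \<phi> \<mu> 1 b x = \<phi> * (\<integral>p. snd p * (1 / (\<phi> + x * fst p) ^ b) \<partial>\<mu>)"
  by (simp add: spec_I_star_def case_prod_unfold)

text \<open>Write \<open>x * l\<close> as \<open>(\<phi> + x * l) - \<phi>\<close> in the numerator.
  This eliminates the one starred functional that escapes the comparison, since
  \<open>l / (\<phi> + x * l)^2\<close> is not decreasing in \<open>l\<close>.\<close>

lemma spec_I_star_relation:
  assumes "0 \<le> x"
  shows "x * spec_I_star \<phi> \<mu> 2 2 x = spec_I_star \<phi> \<mu> 1 1 x - \<phi> * spec_I_star \<phi> \<mu> 1 2 x"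
proof -
  let ?h = "\<lambda>b (p::real \<times> real). snd p * (1 / (\<phi> + x * fst p) ^ b)"
  have int: "integrable \<mu> (?h b)" for b
    using inverse_denom_power_bounded[OF assms]
    by (intro integrable_snd_mult[where K = "1 / \<phi> ^ b"]) auto
  have "x * spec_I_star \<phi> \<mu> 2 2 x =
      \<phi> * (\<integral>p. x * (snd p * fst p / (\<phi> + x * fst p)\<^sup>2) \<partial>\<mu>)"
    by (simp only: integral_mult_right_zero) (simp add: spec_I_star_def case_prod_unfold)
  also have "(\<integral>p. x * (snd p * fst p / (\<phi> + x * fst p)\<^sup>2) \<partial>\<mu>) = (\<integral>p. ?h 1 p - \<phi> * ?h 2 p \<partial>\<mu>)"
  proof (rule integral_cong_AE)
    show "AE p in \<mu>. x * (snd p * fst p / (\<phi> + x * fst p)\<^sup>2) = ?h 1 p - \<phi> * ?h 2 p"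
      using AE_nonneg
    proof eventually_elim
      case (elim p)
      then have "\<phi> + x * fst p \<noteq> 0"
        using denom_pos[OF assms] by force
      then show ?case
        by (simp add: divide_simps power2_eq_square) (simp add: algebra_simps)
    qed
  qed measurable
  also have "\<dots> = (\<integral>p. ?h 1 p \<partial>\<mu>) - \<phi> * (\<integral>p. ?h 2 p \<partial>\<mu>)"
    by (subst Bochner_Integration.integral_diff)
      (simp_all only: integral_mult_right_zero int integrable_mult_right)
  finally show ?thesis
    unfolding spec_I_star_1_eq by (simp add: algebra_simps)
qed

end

end

lemma spec_I_star_1_mono:
  assumes \<mu>: "ljsd \<mu>1" "ljsd \<mu>2" "ljsd_le \<mu>1 \<mu>2" "test_scale \<mu>1 = test_scale \<mu>2"
    and pos: "\<phi> > 0" "0 \<le> x"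
  shows "spec_I_star \<phi> \<mu>1 1 b x \<le> spec_I_star \<phi> \<mu>2 1 b x"
proof -
  interpret A: ljsd_measure \<mu>1 by (rule ljsd_measureI) fact
  interpret B: ljsd_measure \<mu>2 by (rule ljsd_measureI) fact
  let ?f = "\<lambda>l. 1 / (\<phi> + x * l) ^ b"
  have "antimono_on {0..} ?f"
  proof (rule monotone_onI)
    fix l l' :: real
    assume "l \<in> {0..}" "l' \<in> {0..}" "l \<le> l'"
    then show "?f l' \<le> ?f l"
      using pos by (intro divide_left_mono power_mono mult_pos_pos zero_less_power A.denom_pos
          add_left_mono mult_left_mono) (auto simp: less_imp_le A.denom_pos)
  qed
  then have "(\<integral>p. snd p * ?f (fst p) \<partial>\<mu>1) \<le> (\<integral>p. snd p * ?f (fst p) \<partial>\<mu>2)"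
    using A.inverse_denom_power_bounded[OF pos]
    by (intro ljsd_le_integral_antimono[OF \<mu>, where K = "1 / \<phi> ^ b"]) auto
  then show ?thesis
    unfolding A.spec_I_star_1_eq[OF pos(1)] B.spec_I_star_1_eq[OF pos(1)] using pos by simp
qed

section \<open>Bias and error\<close>

text \<open>The error at \<open>\<xi> = 1\<close> as an affine function of \<open>J11\<close> and \<open>J12\<close>. The noise condition enters
  through the coefficient of \<open>J12\<close>: its negative part \<open>\<rho> \<gamma> \<tau>b (\<phi> I12 + v) / D\<close> is at most 1 since
  \<open>D \<ge> \<rho> \<gamma> \<tau>b (\<omega> + \<phi> I12)\<close>.\<close>

lemma error_mono:
  fixes \<phi> \<psi> \<gamma> v \<rho> \<omega> x \<tau> \<tau>b I11 I12 I22 D :: real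
  defines "E \<equiv> \<lambda>J11 J12 J22. \<phi> * J12 + \<rho> * (\<psi> / \<phi>) * (x / D) *
      (I11 * (\<omega> + \<phi> * I12) * (\<omega> + J11) + \<phi>\<^sup>2 / \<psi> * \<gamma> * \<tau>b * I12 * J22 + \<gamma> * \<tau> * I22 * (\<omega> + \<phi> * J12)
       + v * ((\<omega> + \<phi> * I12) * (\<omega> + J11) + \<phi> / \<psi> * \<gamma> * \<tau>b * J22))"
  assumes pos: "\<phi> > 0" "\<psi> > 0" "\<gamma> > 0" "\<rho> > 0" "x \<ge> 0" "\<tau> \<ge> 0" "\<tau>b \<ge> 0"
      "I11 \<ge> 0" "I12 \<ge> 0" "I22 \<ge> 0"
    and v: "0 \<le> v" "v \<le> \<omega>"
    and D: "D = \<gamma> + \<rho> * \<gamma> * (\<tau> * \<psi> / \<phi> + \<tau>b) * (\<omega> + \<phi> * I12)"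
    and J22: "x * J22 = J11 - \<phi> * J12" "x * J22' = J11' - \<phi> * J12'"
    and le: "J11 \<le> J11'" "J12 \<le> J12'"
  shows "E J11 J12 J22 \<le> E J11' J12' J22'"
proof -
  have "\<rho> * \<gamma> * (\<tau> * \<psi> / \<phi>) * (\<omega> + \<phi> * I12) \<ge> 0"
    using pos v by simp
  moreover have "\<rho> * \<gamma> * \<tau>b * (v + \<phi> * I12) \<le> \<rho> * \<gamma> * \<tau>b * (\<omega> + \<phi> * I12)"
    using pos v by (intro mult_left_mono) auto
  ultimately have Dge: "\<rho> * \<gamma> * \<tau>b * (\<phi> * I12 + v) + \<gamma> \<le> D"
    unfolding D by (simp add: algebra_simps)
  have "0 \<le> \<rho> * \<gamma> * \<tau>b * (\<phi> * I12 + v)"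
    using pos v by simp
  with Dge have Dpos: "D > 0"
    using pos by linarith
  \<comment> \<open>The factor \<open>x\<close> of the variance prefactor is left out of
    \<open>k\<close>, so that it can be paired with the third argument of \<open>E\<close> and
    removed by the hypotheses \<open>J22\<close>.\<close>
  define k where "k = \<rho> * (\<psi> / \<phi>) / D"
  define c11 where "c11 = k * (x * (I11 + v) * (\<omega> + \<phi> * I12) + \<phi> / \<psi> * \<gamma> * \<tau>b * (\<phi> * I12 + v))"
  \<comment> \<open>The summand 1 is the bias, the next term comes from
    \<open>\<omega> + \<phi> * J12\<close>, and the negative term from substituting
    \<open>J11 - \<phi> * J12\<close> for \<open>x * J22\<close>.\<close>
  define c12 where "c12 = \<phi> * (1 + k * (x * \<gamma> * \<tau> * I22) - k * (\<phi> / \<psi> * \<gamma> * \<tau>b * (\<phi> * I12 + v)))"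
  define c0 where "c0 = k * (x * (I11 + v) * (\<omega> + \<phi> * I12) * \<omega> + x * \<gamma> * \<tau> * I22 * \<omega>)"
  have k: "k \<ge> 0"
    unfolding k_def using pos Dpos by simp
  have E_eq: "E A B C = c0 + c11 * A + c12 * B"
    if C: "x * C = A - \<phi> * B" for A B C
  proof -
    have "E A B C = \<phi> * B + k *
      (x * (I11 + v) * (\<omega> + \<phi> * I12) * (\<omega> + A) + \<phi> / \<psi> * \<gamma> * \<tau>b * (\<phi> * I12 + v) * (x * C)
       + x * \<gamma> * \<tau> * I22 * (\<omega> + \<phi> * B))"
      unfolding E_def k_def using pos Dpos by (simp add: field_simps power2_eq_square)
    also have "\<dots> = c0 + c11 * A + c12 * B"
      unfolding C c0_def c11_def c12_def by (simp only: distrib_left distrib_right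
        left_diff_distrib right_diff_distrib mult_1_right) (simp add: algebra_simps)
    finally show ?thesis .
  qed
  have "c11 \<ge> 0"
    unfolding c11_def using pos v k by simp
  moreover have "c12 \<ge> 0"
  proof -
    have "k * (\<phi> / \<psi> * \<gamma> * \<tau>b * (\<phi> * I12 + v)) = \<rho> * \<gamma> * \<tau>b * (\<phi> * I12 + v) / D"
      unfolding k_def using pos by simp
    moreover have "\<rho> * \<gamma> * \<tau>b * (\<phi> * I12 + v) / D \<le> 1"
      using Dge Dpos pos by simp
    moreover have "0 \<le> k * (x * \<gamma> * \<tau> * I22)"
      using pos k by simp
    ultimately show ?thesis
      unfolding c12_def using pos by (intro mult_nonneg_nonneg) auto
  qed
  ultimately have "c11 * J11 \<le> c11 * J11'" "c12 * J12 \<le> c12 * J12'"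
    using le by (auto intro: mult_left_mono)
  then show ?thesis
    unfolding E_eq[OF J22(1)] E_eq[OF J22(2)] by simp
qed

theorem corollary5p3:
  fixes \<phi> \<psi> \<gamma> \<sigma>\<epsilon>2 :: real
    and \<sigma> :: "real \<Rightarrow> real"
    and \<mu>1 \<mu>2 :: "(real \<times> real) measure"
  assumes "\<phi> > 0" and "\<psi> > 0" and "\<gamma> > 0" and "\<sigma>\<epsilon>2 \<ge> 0"
    and "admissible_activation \<sigma>"
    and "ljsd \<mu>1" and "ljsd \<mu>2"
    and "act_zeta \<sigma> (train_scale \<mu>1) \<noteq> 0" and "act_zeta \<sigma> (train_scale \<mu>2) \<noteq> 0"
    and "train_scale \<mu>1 = test_scale \<mu>1" and "train_scale \<mu>2 = test_scale \<mu>2"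
    and "ljsd_le \<mu>1 \<mu>2"
  shows "limit_bias \<phi> \<psi> \<gamma> \<sigma> \<mu>1 \<le> limit_bias \<phi> \<psi> \<gamma> \<sigma> \<mu>2 \<and>
    (\<sigma>\<epsilon>2 \<le> act_omega \<sigma> (train_scale \<mu>1) \<longrightarrow>
       limit_error \<phi> \<psi> \<gamma> \<sigma>\<epsilon>2 \<sigma> \<mu>1 \<le> limit_error \<phi> \<psi> \<gamma> \<sigma>\<epsilon>2 \<sigma> \<mu>2)"
proof -
  \<comment> \<open>Oriented to replace test scales by train scales, so that \<omega> at the test
    scale becomes \<omega> at the train scale.\<close>
  note [simp] = assms(10,11)[symmetric]
  interpret A: ljsd_measure \<mu>1 by (rule ljsd_measureI) fact
  interpret B: ljsd_measure \<mu>2 by (rule ljsd_measureI) fact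
  have marg: "train_marginal \<mu>2 = train_marginal \<mu>1"
    using assms(12) by (simp add: ljsd_le_def)
  \<comment> \<open>The training scale is the mean of the marginal; hence all four scales
    coincide.\<close>
  have scale[simp]: "train_scale \<mu>2 = train_scale \<mu>1"
    using A.integral_train_marginal[of "\<lambda>l. l"] B.integral_train_marginal[of "\<lambda>l. l"] marg
    by (simp add: train_scale_def)
  have I[simp]: "spec_I \<phi> \<mu>2 a b y = spec_I \<phi> \<mu>1 a b y" for a b y
    using A.spec_I_eq B.spec_I_eq marg assms(1) by simp
  define \<rho> where "\<rho> = act_rho \<sigma> (train_scale \<mu>1)"
  define \<omega> where "\<omega> = act_omega \<sigma> (train_scale \<mu>1)"
  define x where "x = x_root \<phi> \<psi> \<gamma> \<sigma> \<mu>1"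
  have \<rho>: "\<rho> > 0"
    unfolding \<rho>_def by (rule act_rho_pos) fact
  have "\<omega> \<ge> 0"
    unfolding \<omega>_def using A.train_scale_pos assms(5,8) by (rule act_omega_nonneg)
  then have x: "x \<ge> 0"
    unfolding x_def using assms(1-3) \<rho> by (intro A.x_root_nonneg) (auto simp: \<rho>_def \<omega>_def)
  have x2: "x_root \<phi> \<psi> \<gamma> \<sigma> \<mu>2 = x"
    by (simp add: x_def x_root_def)
  \<comment> \<open>Positivity of \<rho> makes the quotient under the root 1; for \<rho> = 0 it
    would be 0/0 = 0.\<close>
  have xi: "act_xi \<sigma> \<mu>1 = 1" "act_xi \<sigma> \<mu>2 = 1"
    using \<rho> by (auto simp: act_xi_def \<rho>_def)
  have J: "spec_I_star \<phi> \<mu>1 1 b x \<le> spec_I_star \<phi> \<mu>2 1 b x" for b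
    by (rule spec_I_star_1_mono[OF assms(6,7,12) _ assms(1) x]) simp
  have bias: "limit_bias \<phi> \<psi> \<gamma> \<sigma> \<mu>1 = \<phi> * spec_I_star \<phi> \<mu>1 1 2 x"
    "limit_bias \<phi> \<psi> \<gamma> \<sigma> \<mu>2 = \<phi> * spec_I_star \<phi> \<mu>2 1 2 x"
    unfolding limit_bias_def Let_def xi x2 x_def[symmetric] by simp_all
  \<comment> \<open>The rewriting brings both errors into the form \<open>E\<close> of
    \<open>error_mono\<close>; the minus sign in front of the variance cancels the one in
    \<open>dx_dgamma\<close>.\<close>
  have "limit_error \<phi> \<psi> \<gamma> \<sigma>\<epsilon>2 \<sigma> \<mu>1 \<le> limit_error \<phi> \<psi> \<gamma> \<sigma>\<epsilon>2 \<sigma> \<mu>2" if "\<sigma>\<epsilon>2 \<le> \<omega>"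
    using error_mono[OF assms(1-3) \<rho> x tau_of_nonneg[OF assms(1-3) \<rho> x]
        tau_bar_of_nonneg[OF assms(1-3) \<rho> x] A.spec_I_nonneg[OF assms(1) x, of 1 1]
        A.spec_I_nonneg[OF assms(1) x, of 1 2] A.spec_I_nonneg[OF assms(1) x, of 2 2] assms(4) that
        refl A.spec_I_star_relation[OF assms(1) x] B.spec_I_star_relation[OF assms(1) x] J J]
    by (simp only: limit_error_def bias limit_variance_def dx_dgamma_def Let_def xi x2
        x_def[symmetric] assms(10,11)[symmetric] scale I \<rho>_def[symmetric] \<omega>_def[symmetric]
        one_power2 mult_1_right mult_minus_left mult_minus_right minus_minus)
  then show ?thesis
    unfolding bias \<omega>_def using J[of 2] assms(1) by simp
qed

end
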